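(* For every constant $C>0$ there exists $(\alpha,\gamma)\in[0,1)^2$ with $\alpha\in\mathbb{R}\setminus\mathbb{Q}$ and $\gamma\notin\alpha\mathbb{Z}+\mathbb{Z}$ such that the inequality $$|\gamma-q\alpha+p|\le \frac{C}{q}$$ has only finitely many solutions $(p,q)\in\mathbb{N}^2$ with $\gcd(p,q)=1$. *)

theory Defs
  imports Complex_Main
begin

end

theory Submission
  imports Defs
begin

text \<open>
  Take \<open>\<alpha> > 0\<close> with \<open>\<alpha>\<^sup>2 + A \<alpha> = 1\<close> and \<open>\<gamma> = (r + s \<alpha>) / 2\<close> with \<open>r, s\<close> odd. For a solution
  \<open>(p, q)\<close> with \<open>q\<close> large, \<open>P = 2 p + r\<close> and \<open>Q = 2 q - s\<close> are odd and satisfy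
  \<open>\<bar>P\<^sup>2 + A P Q - Q\<^sup>2\<bar> \<le> K A\<close> with \<open>K\<close> depending on \<open>C\<close> only. Vieta jumping, which only changes
  signs modulo the even number \<open>A\<close>, shows that \<open>(P, Q)\<close> is congruent modulo \<open>A\<close> to a point of
  the box \<open>[-2K, 2K]\<^sup>2\<close>. As this box does not depend on \<open>A\<close>, the Chinese remainder theorem
  provides \<open>r, s, A\<close> such that each of its points \<open>(i, j)\<close> has an odd divisor \<open>l > 1\<close> of \<open>A\<close>
  with \<open>(i, j) \<equiv> (r, -s)\<close> modulo \<open>l\<close>. Then \<open>l\<close> divides \<open>P - r = 2 p\<close> and \<open>Q + s = 2 q\<close>, so
  \<open>p\<close> and \<open>q\<close> are not coprime.
\<close>

text \<open>Induction on \<open>S\<close>: each new point receives a fresh odd modulus coprime to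
  \<open>N\<close>, and the Chinese remainder theorem adjusts \<open>r\<close> and \<open>s\<close>
  without disturbing their residues modulo \<open>N\<close>.\<close>

lemma simultaneous_odd_congruences:
  fixes S :: "(int \<times> int) set"
  assumes "finite S"
  shows "\<exists>N r s. N > 0 \<and> odd r \<and> odd s \<and>
    (\<forall>(i, j) \<in> S. \<exists>l>1. odd l \<and> l dvd N \<and> l dvd i - r \<and> l dvd j - s)"
  using assms
proof (induction S)
  case empty
  show ?case by (rule exI[of _ 1], rule exI[of _ 1], rule exI[of _ 1]) simp
next
  case (insert x S)
  obtain i0 j0 where x: "x = (i0, j0)" by (cases x)
  obtain N r s where N: "N > 0" and odd: "odd r" "odd s"
    and IH: "\<And>i j. (i, j) \<in> S \<Longrightarrow> \<exists>l>1. odd l \<and> l dvd N \<and> l dvd i - r \<and> l dvd j - s"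
    using insert.IH by blast
  \<comment> \<open>The identity \<open>l0 - 2 * N = 1\<close> is an explicit Bezout relation, and
    the even coefficient \<open>2 * N\<close> preserves parity.\<close>
  define l0 where "l0 = 2 * N + 1"
  \<comment> \<open>\<open>c t u\<close> is congruent to \<open>t\<close> modulo \<open>N\<close> and to \<open>u\<close> modulo \<open>l0\<close>\<close>
  define c where "c = (\<lambda>t u. t * l0 - 2 * N * u)"
  have c_odd: "odd (c t u)" if "odd t" for t u
    using that by (simp add: c_def l0_def)
  have cN: "v - c t u = (v - t) + N * (2 * u - 2 * t)" for t u v
    by (simp add: c_def l0_def algebra_simps)
  have cl: "u - c t u = l0 * (u - t)" for t u
    by (simp add: c_def l0_def algebra_simps)
  have "\<exists>l>1. odd l \<and> l dvd N * l0 \<and> l dvd i - c r i0 \<and> l dvd j - c s j0"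
    if mem: "(i, j) \<in> insert x S" for i j
  proof (cases "(i, j) = x")
    case True
    then show ?thesis
      using N x by (intro exI[of _ l0]) (simp add: cl, simp add: l0_def)
  next
    case False
    then obtain l where "l > 1" "odd l" "l dvd N" "l dvd i - r" "l dvd j - s"
      using IH mem by blast
    then show ?thesis
      by (intro exI[of _ l]) (simp add: cN)
  qed
  moreover have "N * l0 > 0" using N by (simp add: l0_def)
  ultimately show ?case using odd c_odd by blast
qed

text \<open>For fixed \<open>P\<close> and fixed value of the form, \<open>Q\<close> and
  \<open>A * P - Q\<close> are the two roots of a quadratic. If the jump failed to shrink
  \<open>Q\<close>, the mixed term would dominate and push the form beyond
  \<open>K * A\<close>.\<close>

lemma vieta_jump_decreases:
  fixes A K P Q :: int
  assumes A: "A > 0" and nz: "P \<noteq> 0" and le: "\<bar>P\<bar> \<le> \<bar>Q\<bar>" and large: "\<bar>Q\<bar> > 2 * K"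
    and f: "\<bar>P\<^sup>2 + A * P * Q - Q\<^sup>2\<bar> \<le> K * A"
  shows "\<bar>A * P - Q\<bar> < \<bar>Q\<bar>"
proof -
  define x y where "x = \<bar>P\<bar>" and "y = \<bar>Q\<bar>"
  have x: "1 \<le> x" and xy: "x \<le> y" and sq: "P\<^sup>2 = x\<^sup>2" "Q\<^sup>2 = y\<^sup>2"
    using nz le by (auto simp: x_def y_def)
  have Ay: "A * y \<le> A * x * y"
    using A x xy by (simp add: mult_le_cancel_right1)
  have xx: "x\<^sup>2 \<le> y\<^sup>2" using x xy by (simp add: power_mono)
  show ?thesis
  proof (cases "P * Q > 0")
    case True
    then have PQ: "A * P * Q = A * x * y" and abs: "\<bar>A * P - Q\<bar> = \<bar>A * x - y\<bar>"
      by (auto simp: x_def y_def zero_less_mult_iff abs_if)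
    have "A * x < 2 * y"
    proof (rule ccontr)
      assume "\<not> A * x < 2 * y"
      then have "(2 * y) * y \<le> (A * x) * y"
        using x xy by (intro mult_right_mono) auto
      then have "2 * y\<^sup>2 \<le> A * x * y" by (simp add: power2_eq_square)
      then have "A * x * y \<le> 2 * (K * A)"
        using f[unfolded PQ sq] zero_le_power2[of x] by linarith
      then have "A * y \<le> A * (2 * K)" using Ay by (simp add: algebra_simps)
      then show False using A large by (simp add: y_def)
    qed
    moreover have "A * x > 0" using A x by simp
    ultimately show ?thesis unfolding abs y_def[symmetric] by linarith
  next
    case False
    then have PQ: "A * P * Q = - (A * x * y)"
      by (auto simp: x_def y_def zero_less_mult_iff abs_if)
    have "A * y \<le> A * K"
      using f[unfolded PQ sq] xx Ay by (simp add: mult.commute)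
    then have "y \<le> K" using A by simp
    then show ?thesis using large x xy by (simp add: y_def)
  qed
qed

text \<open>Descent on \<open>\<bar>P\<bar> + \<bar>Q\<bar>\<close>: outside the box, jump the
  larger coordinate. As \<open>A\<close> is even, both coordinates stay odd, hence nonzero, so the
  descent can continue.\<close>

lemma small_form_value_congruent_to_box:
  fixes A K P Q :: int
  assumes A: "A > 0" "even A"
    and "odd P" "odd Q" "\<bar>P\<^sup>2 + A * P * Q - Q\<^sup>2\<bar> \<le> K * A"
  shows "\<exists>i j. \<bar>i\<bar> \<le> 2 * K \<and> \<bar>j\<bar> \<le> 2 * K \<and> A dvd P - i \<and> A dvd Q - j"
  using assms(3-)
proof (induction "nat (\<bar>P\<bar> + \<bar>Q\<bar>)" arbitrary: P Q rule: less_induct)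
  case less
  note f = \<open>\<bar>P\<^sup>2 + A * P * Q - Q\<^sup>2\<bar> \<le> K * A\<close>
  have nz: "P \<noteq> 0" "Q \<noteq> 0" using less.prems by auto
  consider "\<bar>P\<bar> \<le> 2 * K" "\<bar>Q\<bar> \<le> 2 * K" | "\<bar>P\<bar> \<le> \<bar>Q\<bar>" "\<bar>Q\<bar> > 2 * K"
    | "\<bar>Q\<bar> \<le> \<bar>P\<bar>" "\<bar>P\<bar> > 2 * K"
    by linarith
  then show ?case
  proof cases
    case 1
    then show ?thesis by (intro exI[of _ P] exI[of _ Q]) simp
  next
    case 2
    have dec: "\<bar>A * P - Q\<bar> < \<bar>Q\<bar>"
      using vieta_jump_decreases[OF A(1) nz(1) 2 f] .
    have "P\<^sup>2 + A * P * (A * P - Q) - (A * P - Q)\<^sup>2 = P\<^sup>2 + A * P * Q - Q\<^sup>2"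
      by (simp add: power2_eq_square algebra_simps)
    then obtain i j where ij: "\<bar>i\<bar> \<le> 2 * K" "\<bar>j\<bar> \<le> 2 * K" "A dvd P - i" "A dvd A * P - Q - j"
      using less.hyps[of P "A * P - Q"] dec f less.prems A by fastforce
    have "Q - (- j) = A * P - (A * P - Q - j)" by simp
    then have "A dvd Q - (- j)" using ij(4) by (metis dvd_diff dvd_triv_left)
    then show ?thesis using ij by (intro exI[of _ i] exI[of _ "- j"]) simp
  next
    case 3
    \<comment> \<open>\<open>(P, Q) \<mapsto> (Q, - P)\<close> changes the sign of the form\<close>
    have "\<bar>Q\<^sup>2 + A * Q * (- P) - (- P)\<^sup>2\<bar> \<le> K * A"
      using f by (simp add: algebra_simps abs_le_iff)
    then have "\<bar>A * Q - (- P)\<bar> < \<bar>- P\<bar>"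
      using 3 by (intro vieta_jump_decreases[OF A(1) nz(2)]) auto
    then have dec: "\<bar>- (A * Q) - P\<bar> < \<bar>P\<bar>" by linarith
    have "(- (A * Q) - P)\<^sup>2 + A * (- (A * Q) - P) * Q - Q\<^sup>2 = P\<^sup>2 + A * P * Q - Q\<^sup>2"
      by (simp add: power2_eq_square algebra_simps)
    then obtain i j where ij: "\<bar>i\<bar> \<le> 2 * K" "\<bar>j\<bar> \<le> 2 * K" "A dvd - (A * Q) - P - i" "A dvd Q - j"
      using less.hyps[of "- (A * Q) - P" Q] dec f less.prems A by fastforce
    have "P - (- i) = - (A * Q) - (- (A * Q) - P - i)" by simp
    then have "A dvd P - (- i)" using ij(3) by (metis dvd_diff dvd_minus_iff dvd_triv_left)
    then show ?thesis using ij by (intro exI[of _ "- i"] exI[of _ j]) simp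
  qed
qed

text \<open>Rational root argument: a rational root of this monic equation is an integer, and none
  lies strictly between 0 and 1.\<close>

lemma quadratic_unit_irrational:
  fixes \<alpha> :: real and A :: int
  assumes root: "\<alpha>\<^sup>2 + A * \<alpha> = 1" and bounds: "0 < \<alpha>" "\<alpha> < 1"
  shows "\<alpha> \<notin> \<rat>"
proof
  assume "\<alpha> \<in> \<rat>"
  then obtain m n :: nat where n: "n \<noteq> 0" and mn: "\<bar>\<alpha>\<bar> = m / n" and cop: "coprime m n"
    by (rule Rats_abs_nat_div_natE)
  have \<alpha>: "\<alpha> = m / n" using mn bounds by simp
  have "(real m)\<^sup>2 + A * real m * real n = (real n)\<^sup>2"
    using root n unfolding \<alpha> by (simp add: field_simps power2_eq_square)
  then have "real_of_int ((int m)\<^sup>2 + A * int m * int n) = real_of_int ((int n)\<^sup>2)"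
    by simp
  then have "(int m)\<^sup>2 = int n * (int n - A * int m)"
    unfolding of_int_eq_iff by (simp add: power2_eq_square algebra_simps)
  then have "int n dvd (int m)\<^sup>2" by simp
  moreover have "coprime (int n) ((int m)\<^sup>2)"
    using cop by (simp add: coprime_commute)
  ultimately have "is_unit (int n)" by (metis coprime_absorb_left)
  then have "n = 1" by simp
  then show False using \<alpha> bounds by simp
qed

text \<open>Substituting \<open>P = Q * \<alpha> + d\<close> cancels the \<open>Q\<^sup>2\<close>
  term. What remains is linear in \<open>A\<close>, with a factor depending only on
  \<open>B\<close>.\<close>

lemma form_value_le_of_approximation:
  fixes \<alpha> B :: real and A P Q :: int
  assumes root: "\<alpha>\<^sup>2 + A * \<alpha> = 1" and bounds: "0 < \<alpha>" "\<alpha> < 1" and A: "A \<ge> 2"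
    and Q: "Q > 0" "B \<le> Q" and approx: "\<bar>Q * \<alpha> - P\<bar> \<le> B / Q"
  shows "\<bar>P\<^sup>2 + A * P * Q - Q\<^sup>2\<bar> \<le> (2 * B + 1) * A"
proof -
  define d where "d = P - Q * \<alpha>"
  have B: "B \<ge> 0"
    using approx Q by (metis abs_ge_zero divide_less_0_iff of_int_0_less_iff order_trans not_le)
  have d: "\<bar>d\<bar> * Q \<le> B"
    using approx Q by (simp add: d_def field_simps abs_minus_commute)
  have d1: "\<bar>d\<bar> \<le> 1"
  proof -
    have "\<bar>d\<bar> * real_of_int Q \<le> 1 * real_of_int Q" using d Q(2) by linarith
    then show ?thesis by (rule mult_right_le_imp_le) (use Q in simp)
  qed
  have "real_of_int (P\<^sup>2 + A * P * Q - Q\<^sup>2) = d\<^sup>2 + (d * Q) * (A + 2 * \<alpha>) + Q\<^sup>2 * (\<alpha>\<^sup>2 + A * \<alpha> - 1)"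
    by (simp add: d_def power2_eq_square algebra_simps)
  also have "\<dots> = d\<^sup>2 + (d * Q) * (A + 2 * \<alpha>)" using root by simp
  also have "\<bar>\<dots>\<bar> \<le> \<bar>d\<^sup>2\<bar> + \<bar>d * Q\<bar> * \<bar>A + 2 * \<alpha>\<bar>"
    by (metis abs_mult abs_triangle_ineq)
  also have "\<dots> \<le> 1 + B * (2 * A)"
  proof (intro add_mono mult_mono)
    show "\<bar>d\<^sup>2\<bar> \<le> 1" using d1 by (simp add: abs_square_le_1)
    show "\<bar>d * Q\<bar> \<le> B" using d Q by (simp add: abs_mult)
    show "\<bar>A + 2 * \<alpha>\<bar> \<le> 2 * A" using A bounds by simp
  qed (use B in auto)
  also have "\<dots> \<le> (2 * B + 1) * A" using A by (simp add: algebra_simps)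
  finally show ?thesis by simp
qed

theorem theorem1p1:
  fixes C :: real
  assumes "C > 0"
  shows "\<exists>\<alpha> \<gamma> :: real.
    \<alpha> \<in> {0..<1} \<and> \<gamma> \<in> {0..<1} \<and>
    \<alpha> \<in> \<real> - \<rat> \<and>
    \<gamma> \<notin> {\<alpha> * of_int m + of_int n | m n :: int. True} \<and>
    finite {(p :: nat, q :: nat). p \<ge> 1 \<and> q \<ge> 1 \<and> gcd p q = 1 \<and>
      \<bar>\<gamma> - real q * \<alpha> + real p\<bar> \<le> C / real q}"
proof -
  \<comment> \<open>This is \<open>2 * B + 1\<close> for \<open>B = 6 * C\<close>: a factor 2 comes
    from clearing the denominator of \<open>\<gamma>\<close>, a factor 3 from
    \<open>Q \<le> 3 * q\<close>.\<close>
  define K where "K = \<lceil>12 * C + 1\<rceil>"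
  define box where "box = {- (2 * K)..2 * K}"
  obtain N r s0 :: int where N: "N > 0" and r: "odd r" and s0: "odd s0"
    and cover: "\<And>i j. i \<in> box \<Longrightarrow> j \<in> box \<Longrightarrow>
      \<exists>l>1. odd l \<and> l dvd N \<and> l dvd i - r \<and> l dvd j - s0"
    using simultaneous_odd_congruences[of "box \<times> box"] by (auto simp: box_def)
  define A where "A = 2 * N"
  have A: "A \<ge> 2" "even A" using N by (auto simp: A_def)

  define \<alpha> :: real where "\<alpha> = (sqrt (A\<^sup>2 + 4) - A) / 2"
  have root: "\<alpha>\<^sup>2 + A * \<alpha> = 1"
    by (simp add: \<alpha>_def power2_eq_square field_simps)
  have "sqrt (A\<^sup>2 + 4) > A" by (rule real_less_rsqrt) simp
  then have \<alpha>0: "\<alpha> > 0" by (simp add: \<alpha>_def)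
  have A\<alpha>: "A * \<alpha> > 0" "A * \<alpha> < 1"
    using root A \<alpha>0 by (simp, metis add_less_same_cancel2 add.commute less_add_same_cancel2 zero_less_power)
  have \<alpha>1: "\<alpha> < 1"
  proof -
    have "1 * \<alpha> \<le> A * \<alpha>" using A \<alpha>0 by (intro mult_right_mono) auto
    then show ?thesis using A\<alpha> by simp
  qed
  have irrational: "\<alpha> \<notin> \<rat>" using quadratic_unit_irrational root \<alpha>0 \<alpha>1 .

  \<comment> \<open>The residue of \<open>s\<close> modulo \<open>A\<close> is prescribed, and \<open>A \<alpha> < 1\<close> leaves room to put \<open>\<gamma>\<close> into \<open>[0, 1)\<close>.\<close>
  define m where "m = \<lceil>(s0 * \<alpha> - r) / (A * \<alpha>)\<rceil>"
  define s where "s = A * m - s0"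
  define \<gamma> where "\<gamma> = (r + s * \<alpha>) / 2"
  have s: "odd s" using A s0 by (simp add: s_def)
  have "(s0 * \<alpha> - r) / (A * \<alpha>) \<le> m" "m - 1 < (s0 * \<alpha> - r) / (A * \<alpha>)"
    unfolding m_def by linarith+
  then have "s0 * \<alpha> - r \<le> m * (A * \<alpha>)" "(m - 1) * (A * \<alpha>) < s0 * \<alpha> - r"
    using A\<alpha>(1) by (simp_all only: pos_divide_le_eq pos_less_divide_eq)
  then have \<gamma>: "0 \<le> \<gamma>" "\<gamma> < 1"
    using A\<alpha> by (simp_all add: \<gamma>_def s_def algebra_simps)
  have notin: "\<gamma> \<noteq> \<alpha> * of_int u + of_int v" for u v
  proof
    assume "\<gamma> = \<alpha> * of_int u + of_int v"
    then have eq: "\<alpha> * of_int (s - 2 * u) = of_int (2 * v - r)"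
      by (simp add: \<gamma>_def field_simps)
    \<comment> \<open>Oddness of \<open>s\<close> allows solving for \<open>\<alpha>\<close>, which
      would then be rational.\<close>
    have "s - 2 * u \<noteq> 0" using s by (metis dvd_triv_left eq_iff_diff_eq_0)
    then have "\<alpha> = of_int (2 * v - r) / of_int (s - 2 * u)"
      using eq by (metis nonzero_eq_divide_eq of_int_eq_0_iff)
    then show False using irrational by (metis Rats_divide Rats_of_int)
  qed

  \<comment> \<open>From \<open>\<bar>s\<bar>\<close> on, \<open>Q = 2 * q - s\<close> lies between
    \<open>q\<close> and \<open>3 * q\<close>; the other bound ensures
    \<open>B \<le> Q\<close>.\<close>
  define q0 where "q0 = max (real_of_int \<bar>s\<bar>) (6 * C)"
  have q_small: "real q < q0"
    if pq: "q \<ge> 1" "gcd p q = 1" "\<bar>\<gamma> - real q * \<alpha> + real p\<bar> \<le> C / real q" for p q :: nat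
  proof (rule ccontr)
    assume "\<not> real q < q0"
    then have q: "\<bar>s\<bar> \<le> int q" "6 * C \<le> q" by (auto simp: q0_def)
    define P Q where "P = 2 * int p + r" and "Q = 2 * int q - s"
    have Q: "int q \<le> Q" "Q \<le> 3 * int q" "Q > 0" "6 * C \<le> Q"
      using q pq(1) by (auto simp: Q_def)
    have "real_of_int Q \<le> 3 * real q" using Q(2) by linarith
    have "Q * \<alpha> - P = - 2 * (\<gamma> - real q * \<alpha> + real p)"
      by (simp add: P_def Q_def \<gamma>_def field_simps)
    then have "\<bar>Q * \<alpha> - P\<bar> \<le> 2 * C / q" using pq(3) by (simp add: abs_mult)
    also have "\<dots> = 6 * C / (3 * q)" by simp
    also have "\<dots> \<le> 6 * C / Q"
      using Q \<open>C > 0\<close> pq(1) \<open>real_of_int Q \<le> 3 * real q\<close> by (intro divide_left_mono) auto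
    finally have "real_of_int \<bar>P\<^sup>2 + A * P * Q - Q\<^sup>2\<bar> \<le> (2 * (6 * C) + 1) * A"
      using form_value_le_of_approximation[OF root \<alpha>0 \<alpha>1 A(1) Q(3,4)] by simp
    also have "\<dots> \<le> real_of_int K * A"
      using A by (intro mult_right_mono) (auto simp: K_def)
    finally have "\<bar>P\<^sup>2 + A * P * Q - Q\<^sup>2\<bar> \<le> K * A"
      by (metis of_int_le_iff of_int_mult)
    moreover have "odd P" "odd Q" using r s by (auto simp: P_def Q_def)
    moreover have "A > 0" using A by simp
    ultimately obtain i j where "\<bar>i\<bar> \<le> 2 * K" "\<bar>j\<bar> \<le> 2 * K"
      and ij: "A dvd P - i" "A dvd Q - j"
      using small_form_value_congruent_to_box A(2) by blast
    then have "i \<in> box" "j \<in> box" by (auto simp: box_def)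
    then obtain l where l: "l > 1" "odd l" "l dvd N" "l dvd i - r" "l dvd j - s0"
      using cover by blast
    have lA: "l dvd A" using l(3) by (simp add: A_def)
    have "2 * int p = (P - i) + (i - r)" by (simp add: P_def)
    then have "l dvd 2 * int p" using lA ij(1) l(4) by (metis dvd_add dvd_trans)
    moreover have "2 * int q = (Q - j) + (j - s0) + A * m" by (simp add: Q_def s_def)
    then have "l dvd 2 * int q" using lA ij(2) l(5) by (metis dvd_add dvd_trans dvd_mult2)
    \<comment> \<open>Oddness of \<open>l\<close> is what cancels the factor 2 and passes the
      divisibility to \<open>p\<close> and \<open>q\<close>.\<close>
    moreover have "coprime l 2" using l(2) by simp
    ultimately have "l dvd int p" "l dvd int q"
      by (simp_all add: coprime_dvd_mult_right_iff)
    then have "l dvd gcd (int p) (int q)" by (rule gcd_greatest)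
    then show False using l(1) pq(2) by simp
  qed
  \<comment> \<open>The inequality ties \<open>p\<close> to \<open>q * \<alpha> - \<gamma>\<close>,
    so bounding \<open>q\<close> bounds \<open>p\<close>.\<close>
  have p_small: "real p < q0 + C"
    if pq: "q \<ge> 1" "gcd p q = 1" "\<bar>\<gamma> - real q * \<alpha> + real p\<bar> \<le> C / real q" for p q :: nat
  proof -
    have "C / q \<le> C" using pq(1) \<open>C > 0\<close> by (simp add: field_simps)
    moreover have "real q * \<alpha> \<le> q" using \<alpha>1 by (simp add: mult_left_le)
    ultimately show ?thesis using pq(3) q_small[OF pq] \<gamma>(1) by linarith
  qed
  have "finite {(p :: nat, q :: nat). p \<ge> 1 \<and> q \<ge> 1 \<and> gcd p q = 1 \<and>
      \<bar>\<gamma> - real q * \<alpha> + real p\<bar> \<le> C / real q}"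
  proof (rule finite_subset)
    have "p \<le> nat \<lceil>q0 + C\<rceil>" "q \<le> nat \<lceil>q0\<rceil>"
      if "q \<ge> 1" "gcd p q = 1" "\<bar>\<gamma> - real q * \<alpha> + real p\<bar> \<le> C / real q" for p q :: nat
      using p_small[OF that] q_small[OF that] by linarith+
    then show "{(p :: nat, q :: nat). p \<ge> 1 \<and> q \<ge> 1 \<and> gcd p q = 1 \<and>
        \<bar>\<gamma> - real q * \<alpha> + real p\<bar> \<le> C / real q}
      \<subseteq> {..nat \<lceil>q0 + C\<rceil>} \<times> {..nat \<lceil>q0\<rceil>}"
      by auto
  qed simp
  moreover have "\<alpha> \<in> \<real>" by (simp add: Reals_def)
  ultimately show ?thesis
    using \<alpha>0 \<alpha>1 \<gamma> irrational notin by (intro exI[of _ \<alpha>] exI[of _ \<gamma>]) auto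
qed

end
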